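(* For every integer $n\ge 4$ with $3\nmid n$, there exists a Universal Cycle for $3$-multisets of $[n]=\{1,\ldots,n\}$.
   Context: A Universal Cycle for $3$-multisets of $[n]$ is a cyclic sequence $a_1a_2\cdots a_k$ of $k=\binom{n+2}{3}$ entries from $[n]$ such that the $k$ multisets $\{a_i,a_{i+1},a_{i+2}\}$ ($i=1,\ldots,k$, indices taken cyclically modulo $k$) are pairwise distinct; equivalently, every $3$-multiset of $[n]$ appears exactly once as the multiset of $3$ cyclically consecutive entries. *)

theory Defs
  imports Complex_Main "HOL-Library.Multiset"
begin

definition cyclic_window3 :: "'a list \<Rightarrow> nat \<Rightarrow> 'a multiset" where
  "cyclic_window3 xs i =
     {# xs ! (i mod length xs), xs ! ((i + 1) mod length xs), xs ! ((i + 2) mod length xs) #}"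

text \<open>The list \<open>xs = [a\<^sub>1, \<dots>, a\<^sub>k]\<close> represents the cyclic sequence; list positions are
  0-based, so \<open>a\<^sub>i\<close> is \<open>xs ! (i - 1)\<close>.\<close>

definition universal_cycle3 :: "nat \<Rightarrow> nat list \<Rightarrow> bool" where
  "universal_cycle3 n xs \<longleftrightarrow>
     length xs = (n + 2) choose 3 \<and>
     set xs \<subseteq> {1..n} \<and>
     inj_on (cyclic_window3 xs) {0..<length xs}"

end

theory Submission
  imports Defs "Graph_Theory.Euler"
begin

text \<open>
  Place \<open>1, \<dots>, n\<close> on a circle. A 3-multiset cuts the circle into three cyclic gaps \<open>a\<close>, \<open>b\<close>, \<open>c\<close>
  with \<open>a + b + c = n\<close>, and reading the multiset clockwise amounts to leaving out one gap. If two
  gaps coincide, leave out the third one (the three are never equal, as \<open>n\<close> is not divisible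
  by 3); otherwise leave out the largest gap, where \<open>n/2\<close> counts as the smallest. Each multiset
  thus becomes an arc \<open>(x, y) \<rightarrow> (y, z)\<close>, and a universal cycle is an Euler circuit of these arcs.

  The rule is invariant under rotation of the circle and under swapping the two gaps that are kept,
  which makes in- and outdegrees agree. The loops \<open>(x, x)\<close> are joined to each other through
  \<open>(x, x + 1)\<close>, every pair with gap below \<open>n/2\<close> is joined to a loop, and for \<open>n \<ge> 6\<close> pairs with gap
  exactly \<open>n/2\<close> are joined to pairs with gap 1, thanks to the special rank of \<open>n/2\<close>. This last point
  fails for \<open>n = 4\<close>, where a cycle is given explicitly.
\<close>

definition gap :: "nat \<Rightarrow> nat \<Rightarrow> nat \<Rightarrow> nat" where
  "gap n x y = (if x \<le> y then y - x else n + y - x)"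

text \<open>\<open>Suc d\<close> keeps rank 0 free for the gap n/2, so distinct gaps have distinct
  ranks.\<close>

definition gap_rank :: "nat \<Rightarrow> nat \<Rightarrow> nat" where
  "gap_rank n d = (if 2 * d = n then 0 else Suc d)"

text \<open>\<open>n - a - b\<close> is the gap left out; strictness forbids keeping two different
  gaps when one of them equals it.\<close>

definition admissible :: "nat \<Rightarrow> nat \<Rightarrow> nat \<Rightarrow> bool" where
  "admissible n a b \<longleftrightarrow> a + b \<le> n \<and>
     (a = b \<or> gap_rank n a < gap_rank n (n - a - b) \<and> gap_rank n b < gap_rank n (n - a - b))"

definition window_arcs :: "nat \<Rightarrow> (nat \<times> nat \<times> nat) set" where
  "window_arcs n = {(x, y, z). x \<in> {1..n} \<and> y \<in> {1..n} \<and> z \<in> {1..n} \<and>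
     admissible n (gap n x y) (gap n y z)}"

text \<open>Pairs with gap above n/2 lie on no arc; as isolated vertices they would spoil strong
  connectivity.\<close>

definition window_graph :: "nat \<Rightarrow> (nat \<times> nat, nat \<times> nat \<times> nat) pre_digraph" where
  "window_graph n = \<lparr>verts = {(x, y). x \<in> {1..n} \<and> y \<in> {1..n} \<and> 2 * gap n x y \<le> n},
     arcs = window_arcs n, tail = (\<lambda>(x, y, z). (x, y)), head = (\<lambda>(x, y, z). (y, z))\<rparr>"

definition triple_mset :: "'a \<times> 'a \<times> 'a \<Rightarrow> 'a multiset" where
  "triple_mset = (\<lambda>(x, y, z). {#x, y, z#})"

lemma finite_window_arcs: "finite (window_arcs n)"
proof (rule finite_subset)
  show "window_arcs n \<subseteq> {1..n} \<times> {1..n} \<times> {1..n}"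
    by (auto simp: window_arcs_def)
qed simp

section \<open>Rotations of a triple of gaps\<close>

lemma admissible_commute: "admissible n a b \<longleftrightarrow> admissible n b a"
proof -
  have "n - a - b = n - b - a" "a + b = b + a"
    by simp_all
  then show ?thesis
    unfolding admissible_def by metis
qed

text \<open>Apart from the gap n/2, a kept gap equals the other kept gap or is smaller than the one
  left out, and two gaps together are at most \<open>n\<close>.\<close>

lemma admissible_le_half:
  assumes "admissible n a b"
  shows "2 * a \<le> n"
proof (cases "a = b \<or> 2 * a = n")
  case True
  then show ?thesis
    using assms by (auto simp: admissible_def)
next
  case False
  then have "a < n - a - b"
    using assms by (auto simp: admissible_def gap_rank_def split: if_splits)
  then show ?thesis
    by linarith
qed

lemma gap_rank_inject: "gap_rank n a = gap_rank n b \<longleftrightarrow> a = b"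
  by (auto simp: gap_rank_def)

text \<open>Two equal gaps can be kept; three distinct gaps have distinct ranks, and the one of
  largest rank is left out.\<close>

lemma admissible_rotation_exists:
  assumes "a + b + c = n"
  shows "admissible n a b \<or> admissible n b c \<or> admissible n c a"
proof -
  have gaps: "n - a - b = c" "n - b - c = a" "n - c - a = b"
    and sums: "a + b \<le> n" "b + c \<le> n" "c + a \<le> n"
    using assms by auto
  show ?thesis
  proof (cases "a = b \<or> b = c \<or> c = a")
    case True
    then show ?thesis
      unfolding admissible_def using sums by metis
  next
    case False
    then have "gap_rank n a \<noteq> gap_rank n b" "gap_rank n b \<noteq> gap_rank n c"
      "gap_rank n c \<noteq> gap_rank n a"
      by (simp_all add: gap_rank_inject)
    then show ?thesis
      unfolding admissible_def gaps using sums by (metis less_trans linorder_neqE_nat)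
  qed
qed

text \<open>Two equalities would make all gaps equal and \<open>n\<close> a multiple of 3; any other
  combination of the two conditions contradicts a strict rank inequality.\<close>

lemma admissible_rotation_unique:
  assumes "a + b + c = n" "\<not> 3 dvd n" "admissible n a b"
  shows "\<not> admissible n b c"
proof -
  have gaps: "n - a - b = c" "n - b - c = a"
    using assms by auto
  have "\<not> (a = b \<and> b = c)"
    using assms(1,2) by presburger
  then show ?thesis
    using assms(3) unfolding admissible_def gaps by auto
qed

section \<open>Orderings of three points on the circle\<close>

lemma gap_refl [simp]: "gap n x x = 0"
  by (simp add: gap_def)

lemma gap_add: "x \<le> n \<Longrightarrow> gap n x y + x = (if x \<le> y then y else n + y)"
  by (simp add: gap_def)

text \<open>Going round back to \<open>x\<close> covers a multiple of \<open>n\<close>: not 0, since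
  the points are not all equal, and less than 2n, since the last gap is below
  \<open>n\<close>.\<close>

lemma gap_cycle:
  assumes "x \<in> {1..n}" "y \<in> {1..n}" "z \<in> {1..n}" "gap n x y + gap n y z \<le> n" "\<not> (x = y \<and> y = z)"
  shows "gap n x y + gap n y z + gap n z x = n"
proof -
  have "gap n x y + x = (if x \<le> y then y else n + y)"
    "gap n y z + y = (if y \<le> z then z else n + z)"
    "gap n z x + z = (if z \<le> x then x else n + x)"
    using assms(1-3) by (simp_all add: gap_add)
  then show ?thesis
    using assms by (cases "x \<le> y"; cases "y \<le> z"; cases "z \<le> x") auto
qed

lemma window_arcs_rotate:
  assumes "\<not> 3 dvd n" "(x, y, z) \<in> window_arcs n" "(y, z, x) \<in> window_arcs n"
  shows "x = y \<and> y = z"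
proof (rule ccontr)
  assume "\<not> (x = y \<and> y = z)"
  then have "gap n x y + gap n y z + gap n z x = n"
    using assms(2) by (intro gap_cycle) (auto simp: window_arcs_def admissible_def)
  with admissible_rotation_unique[OF this assms(1)] assms(2,3) show False
    by (auto simp: window_arcs_def)
qed

text \<open>Swapping two points reverses the direction of travel: each gap d becomes n - d, so the
  three sum to 2n and any two exceed \<open>n\<close>.\<close>

lemma gap_reversed:
  assumes "x \<in> {1..n}" "y \<in> {1..n}" "z \<in> {1..n}" "gap n x y + gap n y z \<le> n"
    and "x \<noteq> y" "y \<noteq> z" "x \<noteq> z"
  shows "gap n y x + gap n x z > n \<and> gap n x z + gap n z y > n \<and> gap n z y + gap n y x > n"
proof -
  have "gap n x y + gap n y z + gap n z x = n"
    using assms by (intro gap_cycle) auto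
  moreover have flip: "gap n s t + gap n t s = n \<and> gap n s t > 0"
    if "s \<in> {1..n}" "t \<in> {1..n}" "s \<noteq> t" for s t
    using that by (auto simp: gap_def)
  ultimately show ?thesis
    using flip[of x y] flip[of y z] flip[of z x] assms by linarith
qed

lemma window_arcs_reversed:
  assumes "(x, y, z) \<in> window_arcs n"
    and "(y, x, z) \<in> window_arcs n \<or> (x, z, y) \<in> window_arcs n \<or> (z, y, x) \<in> window_arcs n"
  shows "x = y \<or> y = z \<or> x = z"
proof -
  have "x \<in> {1..n}" "y \<in> {1..n}" "z \<in> {1..n}" "gap n x y + gap n y z \<le> n"
    using assms(1) by (auto simp: window_arcs_def admissible_def)
  note reversed = gap_reversed[OF this]
  have "gap n y x + gap n x z \<le> n \<or> gap n x z + gap n z y \<le> n \<or> gap n z y + gap n y x \<le> n"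
    using assms(2) by (auto simp: window_arcs_def admissible_def)
  with reversed show ?thesis
    by linarith
qed

section \<open>Arcs correspond to 3-multisets\<close>

lemma triple_mset_eq_cases:
  assumes "{#x, y, z#} = {#x', y', z'#}"
  shows "(x', y', z') \<in> {(x, y, z), (y, z, x), (z, x, y), (y, x, z), (x, z, y), (z, y, x)}"
proof -
  have "x' = x \<or> x' = y \<or> x' = z"
    using arg_cong[OF assms, of set_mset] by auto
  moreover have "{#x, y, z#} = {#y, x, z#}" "{#x, y, z#} = {#z, x, y#}"
    by auto
  ultimately consider "x' = x" "{#y, z#} = {#y', z'#}" | "x' = y" "{#x, z#} = {#y', z'#}"
    | "x' = z" "{#x, y#} = {#y', z'#}"
    using assms by (metis add_mset_add_mset_same_iff)
  then show ?thesis
    by cases (auto simp: add_eq_conv_ex)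
qed

lemma inj_on_triple_mset:
  assumes "\<not> 3 dvd n"
  shows "inj_on triple_mset (window_arcs n)"
proof (rule inj_onI)
  fix e e' assume e: "e \<in> window_arcs n" "e' \<in> window_arcs n" "triple_mset e = triple_mset e'"
  obtain x y z x' y' z' where [simp]: "e = (x, y, z)" "e' = (x', y', z')"
    by (metis prod_cases3)
  have "(x', y', z') \<in> {(x, y, z), (y, z, x), (z, x, y), (y, x, z), (x, z, y), (z, y, x)}"
    using e(3) by (intro triple_mset_eq_cases) (simp add: triple_mset_def)
  \<comment> \<open>Two different rotations are never both arcs. A transposition reverses the
    orientation, so two entries agree, and then it is itself a rotation.\<close>
  then show "e = e'"
    using e(1,2) window_arcs_rotate[OF assms, of x y z] window_arcs_rotate[OF assms, of z x y]
      window_arcs_rotate[OF assms, of y z x] window_arcs_reversed[of x y z n]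
    by auto
qed

lemma sorted_triple_rotation:
  assumes "p \<in> {1..n}" "q \<in> {1..n}" "r \<in> {1..n}" "p \<le> q" "q \<le> r"
  shows "{#p, q, r#} \<in> triple_mset ` window_arcs n"
proof -
  have mem: "(p, q, r) \<in> window_arcs n \<or> (q, r, p) \<in> window_arcs n \<or> (r, p, q) \<in> window_arcs n"
  proof (cases "p = r")
    case True
    then show ?thesis
      using assms by (auto simp: window_arcs_def admissible_def)
  next
    case False
    \<comment> \<open>In sorted order the points go round the circle once; only a constant triple
      has gap sum 0.\<close>
    then have "gap n p q + gap n q r + gap n r p = n"
      using assms by (auto simp: gap_def)
    from admissible_rotation_exists[OF this] show ?thesis
      using assms by (auto simp: window_arcs_def)
  qed
  have "triple_mset (p, q, r) = {#p, q, r#}" "triple_mset (q, r, p) = {#p, q, r#}"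
    "triple_mset (r, p, q) = {#p, q, r#}"
    by (auto simp: triple_mset_def)
  with mem show ?thesis
    by (metis imageI)
qed

lemma triple_mset_image:
  "triple_mset ` window_arcs n = multisets_of_size {1..n} 3"
proof (intro equalityI subsetI)
  fix M assume "M \<in> triple_mset ` window_arcs n"
  then show "M \<in> multisets_of_size {1..n} 3"
    by (auto simp: triple_mset_def window_arcs_def multisets_of_size_def)
next
  fix M assume "M \<in> multisets_of_size {1..n} 3"
  then have M: "set_mset M \<subseteq> {1..n}" "size M = 3"
    by (auto simp: multisets_of_size_def)
  have "length (sorted_list_of_multiset M) = 3"
    using M(2) by (metis mset_sorted_list_of_multiset size_mset)
  then obtain p q r where pqr: "sorted_list_of_multiset M = [p, q, r]"
    by (auto simp: numeral_3_eq_3 length_Suc_conv)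
  have "sorted [p, q, r]"
    by (metis pqr sorted_sorted_list_of_multiset)
  moreover have "M = {#p, q, r#}"
    by (metis pqr mset_sorted_list_of_multiset mset.simps)
  ultimately show "M \<in> triple_mset ` window_arcs n"
    using M(1) by (auto intro!: sorted_triple_rotation)
qed

lemma card_window_arcs:
  assumes "\<not> 3 dvd n"
  shows "card (window_arcs n) = (n + 2) choose 3"
proof -
  have "card (window_arcs n) = card (multisets_of_size {1..n} 3)"
    using card_image[OF inj_on_triple_mset[OF assms]] by (simp add: triple_mset_image)
  also have "\<dots> = (n + 2) choose 3"
    by (subst card_multisets_of_size) auto
  finally show ?thesis .
qed

section \<open>Degrees and connectivity of the graph\<close>

lemma fin_digraph_window_graph: "fin_digraph (window_graph n)"
proof
  fix e assume "e \<in> arcs (window_graph n)"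
  then show "tail (window_graph n) e \<in> verts (window_graph n)"
    "head (window_graph n) e \<in> verts (window_graph n)"
    using admissible_le_half admissible_commute
    by (auto simp: window_graph_def window_arcs_def)
next
  show "finite (verts (window_graph n))"
    by (rule finite_subset[of _ "{1..n} \<times> {1..n}"]) (auto simp: window_graph_def)
qed (simp add: window_graph_def finite_window_arcs)

text \<open>Swapping the two gaps matches arcs into \<open>(x, y)\<close> with arcs out of it: the
  point at distance d before \<open>x\<close> corresponds to the point at distance d after
  \<open>y\<close>.\<close>

lemma degrees_window_graph: "in_degree (window_graph n) v = out_degree (window_graph n) v"
proof -
  obtain x y where v: "v = (x, y)"
    by fastforce
  \<comment> \<open>The points at distance d clockwise from \<open>y\<close> and counterclockwise
    from \<open>x\<close>.\<close>
  define fwd where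
    "fwd = (\<lambda>d. if y + d \<le> n then y + d else y + d - n)"
  define bwd where
    "bwd = (\<lambda>d. if d < x then x - d else n + x - d)"
  have fwd: "fwd d \<in> {1..n} \<and> gap n y (fwd d) = d" if "y \<in> {1..n}" "d < n" for d
    using that by (auto simp: fwd_def gap_def)
  have bwd: "bwd d \<in> {1..n} \<and> gap n (bwd d) x = d" if "x \<in> {1..n}" "d < n" for d
    using that by (auto simp: bwd_def gap_def)
  have fwd_gap: "fwd (gap n y z) = z" if "y \<in> {1..n}" "z \<in> {1..n}" for z
    using that by (auto simp: fwd_def gap_def)
  have bwd_gap: "bwd (gap n w x) = w" if "x \<in> {1..n}" "w \<in> {1..n}" for w
    using that by (auto simp: bwd_def gap_def)
  have gap_less: "gap n s t < n" if "s \<in> {1..n}" "t \<in> {1..n}" for s t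
    using that by (auto simp: gap_def)
  have in_arcs: "in_arcs (window_graph n) v = {(w, s, t). s = x \<and> t = y \<and> w \<in> {1..n} \<and>
      x \<in> {1..n} \<and> y \<in> {1..n} \<and> admissible n (gap n w x) (gap n x y)}"
    by (auto simp: in_arcs_def window_graph_def window_arcs_def v)
  have out_arcs: "out_arcs (window_graph n) v = {(s, t, z). s = x \<and> t = y \<and> x \<in> {1..n} \<and>
      y \<in> {1..n} \<and> z \<in> {1..n} \<and> admissible n (gap n x y) (gap n y z)}"
    by (auto simp: out_arcs_def window_graph_def window_arcs_def v)
  have "bij_betw (\<lambda>(w, _, _). (x, y, fwd (gap n w x)))
    (in_arcs (window_graph n) v) (out_arcs (window_graph n) v)"
  proof (rule bij_betw_byWitness[where f' = "\<lambda>(_, _, z). (bwd (gap n y z), x, y)"])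
    show "\<forall>e\<in>in_arcs (window_graph n) v. (\<lambda>(_, _, z). (bwd (gap n y z), x, y))
        ((\<lambda>(w, _, _). (x, y, fwd (gap n w x))) e) = e"
      using in_arcs by (auto simp: fwd bwd_gap gap_less simp del: atLeastAtMost_iff One_nat_def)
    show "\<forall>e\<in>out_arcs (window_graph n) v. (\<lambda>(w, _, _). (x, y, fwd (gap n w x)))
        ((\<lambda>(_, _, z). (bwd (gap n y z), x, y)) e) = e"
      using out_arcs by (auto simp: bwd fwd_gap gap_less simp del: atLeastAtMost_iff One_nat_def)
    show "(\<lambda>(w, _, _). (x, y, fwd (gap n w x))) ` in_arcs (window_graph n) v
        \<subseteq> out_arcs (window_graph n) v"
      unfolding in_arcs out_arcs using admissible_commute
      by (auto simp: fwd gap_less simp del: atLeastAtMost_iff One_nat_def)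
    show "(\<lambda>(_, _, z). (bwd (gap n y z), x, y)) ` out_arcs (window_graph n) v
        \<subseteq> in_arcs (window_graph n) v"
      unfolding in_arcs out_arcs using admissible_commute
      by (auto simp: bwd gap_less simp del: atLeastAtMost_iff One_nat_def)
  qed
  then show ?thesis
    unfolding in_degree_def out_degree_def by (rule bij_betw_same_card)
qed

lemma window_graph_step:
  "(x, y, z) \<in> window_arcs n \<Longrightarrow> (x, y) \<rightarrow>\<^bsub>window_graph n\<^esub> (y, z)"
  by (force simp: arcs_ends_def arc_to_ends_def window_graph_def)

lemma strongly_connected_window_graph:
  assumes "n \<ge> 5"
  shows "strongly_connected (window_graph n)"
proof -
  interpret fin_digraph "window_graph n"
    by (rule fin_digraph_window_graph)
  \<comment> \<open>\<open>(x, x, y)\<close> and \<open>(x, y, y)\<close> keep the gaps 0 and d <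
    n/2; the one left out, n - d, is larger.\<close>
  have out: "(x, x) \<rightarrow>\<^sup>*\<^bsub>window_graph n\<^esub> (x, y)" and into: "(x, y) \<rightarrow>\<^sup>*\<^bsub>window_graph n\<^esub> (y, y)"
    if "x \<in> {1..n}" "y \<in> {1..n}" "2 * gap n x y < n" for x y
    using that
    by (auto intro!: reachable_adjI window_graph_step simp: window_arcs_def admissible_def gap_rank_def)
  have diag_Suc: "(x, x) \<rightarrow>\<^sup>*\<^bsub>window_graph n\<^esub> (Suc x, Suc x)" if "x \<in> {1..n}" "Suc x \<in> {1..n}" for x
  proof -
    have "2 * gap n x (Suc x) < n"
      using assms by (simp add: gap_def)
    then show ?thesis
      using out into that reachable_trans by blast
  qed
  have diag_wrap: "(n, n) \<rightarrow>\<^sup>*\<^bsub>window_graph n\<^esub> (1, 1)"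
  proof -
    have "2 * gap n n 1 < n" "n \<in> {1..n}" "1 \<in> {1..n}"
      using assms by (auto simp: gap_def)
    then show ?thesis
      using out into reachable_trans by blast
  qed
  have up: "(x, x) \<rightarrow>\<^sup>*\<^bsub>window_graph n\<^esub> (y, y)" if "x \<le> y" "x \<in> {1..n}" "y \<in> {1..n}" for x y
    using that
  proof (induction rule: dec_induct)
    case base
    then show ?case
      by (intro reachable_refl) (auto simp: window_graph_def)
  next
    case (step m)
    then have "(x, x) \<rightarrow>\<^sup>*\<^bsub>window_graph n\<^esub> (m, m)" "(m, m) \<rightarrow>\<^sup>*\<^bsub>window_graph n\<^esub> (Suc m, Suc m)"
      by (auto intro!: diag_Suc)
    then show ?case
      by (rule reachable_trans)
  qed
  \<comment> \<open>Climb from \<open>x\<close> to \<open>n\<close>, wrap to 1, then climb to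
    \<open>y\<close>.\<close>
  have diag: "(x, x) \<rightarrow>\<^sup>*\<^bsub>window_graph n\<^esub> (y, y)" if "x \<in> {1..n}" "y \<in> {1..n}" for x y
    using up[of x n] diag_wrap up[of 1 y] that assms
    by (auto intro: reachable_trans)
  have from_diag: "\<exists>t\<in>{1..n}. (t, t) \<rightarrow>\<^sup>*\<^bsub>window_graph n\<^esub> v"
    and to_diag: "\<exists>t\<in>{1..n}. v \<rightarrow>\<^sup>*\<^bsub>window_graph n\<^esub> (t, t)"
    if "v \<in> verts (window_graph n)" for v
  proof -
    obtain x y where v: "v = (x, y)" and xy: "x \<in> {1..n}" "y \<in> {1..n}" "2 * gap n x y \<le> n"
      using \<open>v \<in> verts (window_graph n)\<close> by (auto simp: window_graph_def)
    have "(\<exists>t\<in>{1..n}. (t, t) \<rightarrow>\<^sup>*\<^bsub>window_graph n\<^esub> v) \<and> (\<exists>t\<in>{1..n}. v \<rightarrow>\<^sup>*\<^bsub>window_graph n\<^esub> (t, t))"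
    proof (cases "2 * gap n x y = n")
      case False
      then show ?thesis
        using out[of x y] into[of x y] xy v by auto
    next
      case True
      \<comment> \<open>Circle neighbours before \<open>x\<close> and after \<open>y\<close>: the
        pairs \<open>(w, x)\<close> and \<open>(y, z)\<close> have gap 1, so \<open>out\<close> and
        \<open>into\<close> apply to them.\<close>
      define w where "w = (if x = 1 then n else x - 1)"
      define z where "z = (if y = n then 1 else y + 1)"
      have w: "w \<in> {1..n}" "gap n w x = 1" and z: "z \<in> {1..n}" "gap n y z = 1"
        using xy assms by (auto simp: w_def z_def gap_def)
      \<comment> \<open>\<open>n\<close> is even here. The gap left out is n/2 - 1, which must
        exceed the kept gap 1; the kept gap n/2 has rank 0.\<close>
      have "n \<ge> 6"
        using True assms by presburger
      then have "admissible n 1 (gap n x y)" "admissible n (gap n x y) 1"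
        using True by (auto simp: admissible_def gap_rank_def)
      then have "(w, x) \<rightarrow>\<^sup>*\<^bsub>window_graph n\<^esub> (x, y)" "(x, y) \<rightarrow>\<^sup>*\<^bsub>window_graph n\<^esub> (y, z)"
        using w z xy by (auto intro!: reachable_adjI window_graph_step simp: window_arcs_def)
      moreover have "(w, w) \<rightarrow>\<^sup>*\<^bsub>window_graph n\<^esub> (w, x)" "(y, z) \<rightarrow>\<^sup>*\<^bsub>window_graph n\<^esub> (z, z)"
        using w z xy assms by (auto intro!: out into)
      ultimately show ?thesis
        using w z v reachable_trans by blast
    qed
    then show "\<exists>t\<in>{1..n}. (t, t) \<rightarrow>\<^sup>*\<^bsub>window_graph n\<^esub> v"
      "\<exists>t\<in>{1..n}. v \<rightarrow>\<^sup>*\<^bsub>window_graph n\<^esub> (t, t)"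
      by auto
  qed
  show ?thesis
  proof
    have "(1, 1) \<in> verts (window_graph n)"
      using assms by (auto simp: window_graph_def)
    then show "verts (window_graph n) \<noteq> {}"
      by blast
  next
    fix u v assume "u \<in> verts (window_graph n)" "v \<in> verts (window_graph n)"
    with from_diag to_diag diag show "u \<rightarrow>\<^sup>*\<^bsub>window_graph n\<^esub> v"
      by (meson reachable_trans)
  qed
qed

section \<open>From a closed Euler trail to a cyclic sequence\<close>

lemma (in wf_digraph) strongly_connected_imp_connected:
  assumes "strongly_connected G"
  shows "connected G"
  using assms unfolding connected_def strongly_connected_def
  by (auto intro: reachable_mk_symmetricI)

lemma (in pre_digraph) cas_nth_Suc:
  assumes "cas u p v" "Suc i < length p"
  shows "head G (p ! i) = tail G (p ! Suc i)"
  using assms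
proof (induction p arbitrary: u i)
  case (Cons e es)
  then obtain e' es' where [simp]: "es = e' # es'"
    by (cases es) auto
  show ?case
    using Cons by (cases i) auto
qed simp

lemma (in pre_digraph) cas_last:
  assumes "cas u p v" "p \<noteq> []"
  shows "head G (last p) = v"
  using assms by (induction p arbitrary: u) auto

lemma (in pre_digraph) closed_cas_nth:
  assumes "cas u p u" "i < length p"
  shows "head G (p ! i) = tail G (p ! (Suc i mod length p))"
proof (cases "Suc i = length p")
  case True
  have "p \<noteq> []"
    using assms(2) by auto
  then have "head G (last p) = tail G (p ! 0)"
    using assms(1) cas_last[of u p u] by (cases p) auto
  moreover have "last p = p ! i"
    using True \<open>p \<noteq> []\<close> by (simp add: last_conv_nth flip: True)
  ultimately show ?thesis
    using True by simp
next
  case False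
  then show ?thesis
    using cas_nth_Suc[OF assms(1)] assms(2) by simp
qed

text \<open>The second entry of an arc is the first entry of the next arc, and its third is the
  first entry of the arc after that, so first entries alone recover every arc.\<close>

lemma cyclic_window3_map_fst:
  assumes step: "\<And>i. i < length p \<Longrightarrow> snd (p ! i) =
      (fst (p ! (Suc i mod length p)), fst (snd (p ! (Suc i mod length p))))"
    and i: "i < length p"
  shows "cyclic_window3 (map fst p) i = triple_mset (p ! i)"
proof -
  let ?j = "Suc i mod length p"
  have j: "?j < length p"
    using i by (intro mod_less_divisor) auto
  have k: "Suc ?j mod length p = (i + 2) mod length p"
    by (simp add: mod_Suc_eq)
  have lt: "(i + 2) mod length p < length p"
    using i by (intro mod_less_divisor) auto
  show ?thesis
    using step[OF i] step[OF j] i j k lt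
    by (cases "p ! i") (auto simp: cyclic_window3_def triple_mset_def)
qed

lemma universal_cycle3_ge_5:
  assumes "n \<ge> 5" "\<not> 3 dvd n"
  shows "\<exists>xs. universal_cycle3 n xs"
proof -
  interpret fin_digraph "window_graph n"
    by (rule fin_digraph_window_graph)
  have "connected (window_graph n)"
    using strongly_connected_window_graph[OF assms(1)] by (rule strongly_connected_imp_connected)
  then obtain u p where "euler_trail u p u"
    using closed_euler1 degrees_window_graph by blast
  then have p: "cas u p u" "distinct p" "set p = window_arcs n"
    unfolding euler_trail_def trail_def awalk_def by (auto simp: window_graph_def)
  have window: "cyclic_window3 (map fst p) i = triple_mset (p ! i)" if "i < length p" for i
  proof (rule cyclic_window3_map_fst)
    fix i assume "i < length p"
    from closed_cas_nth[OF p(1) this]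
    show "snd (p ! i) = (fst (p ! (Suc i mod length p)), fst (snd (p ! (Suc i mod length p))))"
      by (simp add: window_graph_def split_beta)
  qed (fact that)
  have "inj_on (cyclic_window3 (map fst p)) {0..<length p}"
  proof (rule inj_onI)
    fix i j assume ij: "i \<in> {0..<length p}" "j \<in> {0..<length p}"
      "cyclic_window3 (map fst p) i = cyclic_window3 (map fst p) j"
    \<comment> \<open>Equal windows come from the same arc, and the trail uses each arc only
      once.\<close>
    then have "p ! i = p ! j"
      using inj_on_triple_mset[OF assms(2)] p(3) by (metis atLeastLessThan_iff inj_onD nth_mem window)
    with ij p(2) show "i = j"
      by (simp add: nth_eq_iff_index_eq)
  qed
  moreover have "length p = (n + 2) choose 3"
    using distinct_card[OF p(2)] card_window_arcs[OF assms(2)] p(3) by simp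
  moreover have "fst ` set p \<subseteq> {1..n}"
    unfolding p(3) by (auto simp: window_arcs_def)
  ultimately have "universal_cycle3 n (map fst p)"
    by (simp add: universal_cycle3_def)
  then show ?thesis ..
qed

text \<open>For n = 4 the arcs at a pair with gap 2 all have the form \<open>(x, y, x)\<close>, so
  these pairs are cut off from the rest of the graph.\<close>

lemma universal_cycle3_4:
  "universal_cycle3 4 [1, 1, 1, 2, 2, 2, 3, 1, 3, 1, 4, 2, 4, 2, 3, 3, 3, 4, 4, 4]"
  (is "universal_cycle3 4 ?xs")
proof -
  \<comment> \<open>A multiset of size 3 is determined by the base 4 digits of this sum.\<close>
  define code where "code = (\<lambda>M. \<Sum>x\<in>#M. (4::nat) ^ x)"
  have len: "length ?xs = 20"
    by simp
  have "distinct (map (code \<circ> cyclic_window3 ?xs) [0..<20])"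
    unfolding code_def by code_simp
  then have "inj_on (code \<circ> cyclic_window3 ?xs) {0..<20}"
    by (simp only: distinct_map set_upt)
  then have "inj_on (cyclic_window3 ?xs) {0..<20}"
    by (rule inj_on_imageI2)
  moreover have "(4 + 2) choose 3 = (20::nat)"
    by code_simp
  moreover have "set ?xs \<subseteq> {1..4}"
    by simp
  ultimately show ?thesis
    unfolding universal_cycle3_def len by simp
qed

theorem theorem8:
  fixes n :: nat
  assumes "n \<ge> 4" and "\<not> 3 dvd n"
  shows "\<exists>xs. universal_cycle3 n xs"
proof (cases "n = 4")
  case True
  then show ?thesis
    using universal_cycle3_4 by blast
next
  case False
  then show ?thesis
    using assms by (intro universal_cycle3_ge_5) auto
qed

end
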